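(* Let $N$ be a finite set of nodes and $f$ a local score function on $N$ such that the directed super-structure $S_f^{\rightarrow}$ is acyclic. Then one can find in time $O(|N|\,\delta_f)$ a dag $D$ on $N$ with maximal score $f(D)$ (maximal among all dags on $N$).
   Context: A dag is a directed acyclic graph; $\mathrm{P}_D(v)$ denotes the set of parents (in-neighbors) of $v$ in a digraph $D$. A local score function $f$ on a finite set $N$ of nodes assigns to each $v\in N$ and each $P\subseteq N\setminus\{v\}$ a non-negative real number $f(v,P)$. The score of a dag $D$ on node set $N$ is $f(D)=\sum_{v\in N} f(v,\mathrm{P}_D(v))$. The function $f$ is given in the non-zero representation, i.e., as a list of all tuples $(v,P,f(v,P))$ with $f(v,P)>0$. Let $\mathcal{P}_f(v)=\{P\subseteq N: f(v,P)>0\}\cup\{\emptyset\}$ and $\delta_f=\max_{v\in N}|\mathcal{P}_f(v)|$. The directed super-structure $S_f^{\rightarrow}$ of $f$ is the digraph on $N$ containing an arc $(u,v)$ if and only if $u\in P$ for some $P\in\mathcal{P}_f(v)$. *)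

theory Defs
  imports Complex_Main
begin

section \<open>Local score functions and dags\<close>

text \<open>A digraph on \<open>N\<close> is given by its arc relation, a subset of \<open>N \<times> N\<close>;
  a pair \<open>(u, v)\<close> is an arc from \<open>u\<close> to \<open>v\<close>.\<close>

definition parents :: "('a \<times> 'a) set \<Rightarrow> 'a \<Rightarrow> 'a set" where
  "parents D v = {u. (u, v) \<in> D}"

definition dag_on :: "'a set \<Rightarrow> ('a \<times> 'a) set \<Rightarrow> bool" where
  "dag_on N D \<longleftrightarrow> D \<subseteq> N \<times> N \<and> acyclic D"

text \<open>A local score function is a partial object: only the values \<open>f v P\<close> with
  \<open>v \<in> N\<close> and \<open>P \<subseteq> N - {v}\<close> are meaningful, and no other value is ever used.\<close>

definition local_score_function :: "'a set \<Rightarrow> ('a \<Rightarrow> 'a set \<Rightarrow> real) \<Rightarrow> bool" where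
  "local_score_function N f \<longleftrightarrow> (\<forall>v\<in>N. \<forall>P. P \<subseteq> N - {v} \<longrightarrow> 0 \<le> f v P)"

definition score :: "'a set \<Rightarrow> ('a \<Rightarrow> 'a set \<Rightarrow> real) \<Rightarrow> ('a \<times> 'a) set \<Rightarrow> real" where
  "score N f D = (\<Sum>v\<in>N. f v (parents D v))"

definition potential_parent_sets :: "'a set \<Rightarrow> ('a \<Rightarrow> 'a set \<Rightarrow> real) \<Rightarrow> 'a \<Rightarrow> 'a set set" where
  "potential_parent_sets N f v = {P. P \<subseteq> N - {v} \<and> f v P > 0} \<union> {{}}"

text \<open>For \<open>N = {}\<close> the value of \<open>delta\<close> is unspecified, but then \<open>card N * delta N f = 0\<close>.
  For \<open>N \<noteq> {}\<close> this product is at least 1, so a time bound \<open>c * max 1 (card N * delta N f)\<close>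
  differs from \<open>c * (card N * delta N f)\<close> only in allowing constant time when there are
  no nodes.\<close>

definition delta :: "'a set \<Rightarrow> ('a \<Rightarrow> 'a set \<Rightarrow> real) \<Rightarrow> nat" where
  "delta N f = Max ((\<lambda>v. card (potential_parent_sets N f v)) ` N)"

definition directed_super_structure ::
    "'a set \<Rightarrow> ('a \<Rightarrow> 'a set \<Rightarrow> real) \<Rightarrow> ('a \<times> 'a) set" where
  "directed_super_structure N f =
     {(u, v). u \<in> N \<and> v \<in> N \<and> (\<exists>P \<in> potential_parent_sets N f v. u \<in> P)}"


section \<open>A real RAM with running times\<close>

text \<open>The machine has registers and a random-access memory, both in two sorts: natural
  numbers (indices and addresses) and real numbers (scores). No instruction turns a real
  number into a natural number, and natural numbers are only added and subtracted, so the
  unit-cost measure cannot be exploited by packing data into a single cell through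
  multiplication or rounding. Programs are structured; every instruction and every
  evaluation of a test takes one time unit.\<close>

record state =
  reg :: "nat \<Rightarrow> nat"
  mem :: "nat \<Rightarrow> nat"
  rreg :: "nat \<Rightarrow> real"
  rmem :: "nat \<Rightarrow> real"

datatype instr =
    Const nat nat
  | Move nat nat
  | Add nat nat nat
  | Sub nat nat nat
  | Load nat nat
  | Store nat nat
  | RConst nat nat
  | RMove nat nat
  | RAdd nat nat nat
  | RSub nat nat nat
  | RMul nat nat nat
  | RDiv nat nat nat
  | RLoad nat nat
  | RStore nat nat

text \<open>The first argument is the target; for the two store instructions it is the
  register holding the target address. Addresses are always natural-number registers.\<close>

fun step :: "instr \<Rightarrow> state \<Rightarrow> state" where
  "step (Const a k) s = s\<lparr>reg := (reg s)(a := k)\<rparr>"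
| "step (Move a b) s = s\<lparr>reg := (reg s)(a := reg s b)\<rparr>"
| "step (Add a b c) s = s\<lparr>reg := (reg s)(a := reg s b + reg s c)\<rparr>"
| "step (Sub a b c) s = s\<lparr>reg := (reg s)(a := reg s b - reg s c)\<rparr>"
| "step (Load a b) s = s\<lparr>reg := (reg s)(a := mem s (reg s b))\<rparr>"
| "step (Store a b) s = s\<lparr>mem := (mem s)(reg s a := reg s b)\<rparr>"
| "step (RConst a k) s = s\<lparr>rreg := (rreg s)(a := real k)\<rparr>"
| "step (RMove a b) s = s\<lparr>rreg := (rreg s)(a := rreg s b)\<rparr>"
| "step (RAdd a b c) s = s\<lparr>rreg := (rreg s)(a := rreg s b + rreg s c)\<rparr>"
| "step (RSub a b c) s = s\<lparr>rreg := (rreg s)(a := rreg s b - rreg s c)\<rparr>"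
| "step (RMul a b c) s = s\<lparr>rreg := (rreg s)(a := rreg s b * rreg s c)\<rparr>"
| "step (RDiv a b c) s = s\<lparr>rreg := (rreg s)(a := rreg s b / rreg s c)\<rparr>"
| "step (RLoad a b) s = s\<lparr>rreg := (rreg s)(a := rmem s (reg s b))\<rparr>"
| "step (RStore a b) s = s\<lparr>rmem := (rmem s)(reg s a := rreg s b)\<rparr>"

datatype test = Less nat nat | Equal nat nat | RLess nat nat

fun holds :: "test \<Rightarrow> state \<Rightarrow> bool" where
  "holds (Less a b) s \<longleftrightarrow> reg s a < reg s b"
| "holds (Equal a b) s \<longleftrightarrow> reg s a = reg s b"
| "holds (RLess a b) s \<longleftrightarrow> rreg s a < rreg s b"

datatype com =
    Skip
  | Instr instr
  | Seq com com
  | If test com com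
  | While test com

text \<open>\<open>exec c s t s'\<close>: program \<open>c\<close> started in state \<open>s\<close> terminates in state \<open>s'\<close> after
  exactly \<open>t\<close> time units.\<close>

inductive exec :: "com \<Rightarrow> state \<Rightarrow> nat \<Rightarrow> state \<Rightarrow> bool" where
  Skip: "exec Skip s 1 s"
| Instr: "exec (Instr i) s 1 (step i s)"
| Seq: "exec c1 s1 t1 s2 \<Longrightarrow> exec c2 s2 t2 s3 \<Longrightarrow> exec (Seq c1 c2) s1 (t1 + t2) s3"
| IfTrue: "holds b s \<Longrightarrow> exec c1 s t s' \<Longrightarrow> exec (If b c1 c2) s (1 + t) s'"
| IfFalse: "\<not> holds b s \<Longrightarrow> exec c2 s t s' \<Longrightarrow> exec (If b c1 c2) s (1 + t) s'"
| WhileFalse: "\<not> holds b s \<Longrightarrow> exec (While b c) s 1 s"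
| WhileTrue: "holds b s1 \<Longrightarrow> exec c s1 t1 s2 \<Longrightarrow> exec (While b c) s2 t2 s3 \<Longrightarrow>
    exec (While b c) s1 (1 + t1 + t2) s3"

inductive_cases exec_SkipE: "exec Skip s t s'"
inductive_cases exec_InstrE: "exec (Instr i) s t s'"
inductive_cases exec_SeqE: "exec (Seq c1 c2) s t s'"
inductive_cases exec_IfE: "exec (If b c1 c2) s t s'"
inductive_cases exec_WhileE: "exec (While b c) s t s'"

lemma exec_deterministic:
  "exec c s t s' \<Longrightarrow> exec c s u s'' \<Longrightarrow> t = u \<and> s' = s''"
proof (induction arbitrary: u s'' rule: exec.induct)
  case (Skip s)
  then show ?case by (auto elim: exec_SkipE)
next
  case (Instr i s)
  then show ?case by (auto elim: exec_InstrE)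
next
  case (Seq c1 s1 t1 s2 c2 t2 s3)
  from Seq.prems obtain u1 u2 r where
    "u = u1 + u2" "exec c1 s1 u1 r" "exec c2 r u2 s''" by (rule exec_SeqE)
  with Seq.IH show ?case by metis
next
  case (IfTrue b s c1 t s' c2)
  from IfTrue.prems IfTrue.hyps obtain u' where "u = 1 + u'" "exec c1 s u' s''"
    by (auto elim: exec_IfE)
  with IfTrue.IH show ?case by metis
next
  case (IfFalse b s c2 t s' c1)
  from IfFalse.prems IfFalse.hyps obtain u' where "u = 1 + u'" "exec c2 s u' s''"
    by (auto elim: exec_IfE)
  with IfFalse.IH show ?case by metis
next
  case (WhileFalse b s c)
  then show ?case by (auto elim: exec_WhileE)
next
  case (WhileTrue b s1 c t1 s2 t2 s3)
  from WhileTrue.prems WhileTrue.hyps obtain u1 u2 r where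
    "u = 1 + u1 + u2" "exec c s1 u1 r" "exec (While b c) r u2 s''"
    by (auto elim: exec_WhileE)
  with WhileTrue.IH show ?case by metis
qed


section \<open>Input and output\<close>

text \<open>A list \<open>vs\<close> enumerates the nodes, and the machine refers to node \<open>vs ! i\<close> by its
  index \<open>i\<close>. A tuple \<open>(v, P, f v P)\<close> becomes a triple of the index of \<open>v\<close>, a list of the
  indices of \<open>P\<close>, and the score. The non-zero representation contains every tuple of
  positive score exactly once; the order of the tuples, and of the members within each
  parent set, is arbitrary.\<close>

definition decode :: "'a list \<Rightarrow> nat \<times> nat list \<times> real \<Rightarrow> 'a \<times> 'a set \<times> real" where
  "decode vs = (\<lambda>(i, is, x). (vs ! i, (!) vs ` set is, x))"

definition nonzero_representation ::
    "'a set \<Rightarrow> ('a \<Rightarrow> 'a set \<Rightarrow> real) \<Rightarrow> 'a list \<Rightarrow> (nat \<times> nat list \<times> real) list \<Rightarrow> bool" where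
  "nonzero_representation N f vs ts \<longleftrightarrow>
     distinct vs \<and> set vs = N \<and>
     (\<forall>(i, is, x) \<in> set ts. i < length vs \<and> distinct is \<and> set is \<subseteq> {..<length vs}) \<and>
     distinct (map (decode vs) ts) \<and>
     set (map (decode vs) ts) = {(v, P, f v P) | v P. v \<in> N \<and> P \<subseteq> N - {v} \<and> f v P > 0}"

text \<open>Parent sets are stored as a length followed by the members. The tuples lie
  consecutively from address 0 on, their scores likewise in the real memory. Registers 0
  and 1 hold the numbers of nodes and of tuples. Everything else is uninitialised.\<close>

definition tuple_cells :: "nat \<times> nat list \<times> real \<Rightarrow> nat list" where
  "tuple_cells = (\<lambda>(i, is, x). i # length is # is)"

definition input_state :: "'a list \<Rightarrow> (nat \<times> nat list \<times> real) list \<Rightarrow> state \<Rightarrow> bool" where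
  "input_state vs ts s \<longleftrightarrow>
     reg s 0 = length vs \<and> reg s 1 = length ts \<and>
     (let cells = concat (map tuple_cells ts)
      in \<forall>k < length cells. mem s k = cells ! k) \<and>
     (\<forall>j < length ts. rmem s j = snd (snd (ts ! j)))"

text \<open>The set of nodes stored at an address in the same format.\<close>

definition stored_set :: "'a list \<Rightarrow> state \<Rightarrow> nat \<Rightarrow> 'a set" where
  "stored_set vs s p = (\<lambda>k. vs ! mem s (p + 1 + k)) ` {..<mem s p}"

text \<open>A dag is output as an array, starting at the address in register 0, whose entry
  \<open>i\<close> is the address at which the parents of \<open>vs ! i\<close> are stored. This may be an address
  within the input: writing out all arcs of a dag can already take quadratic time in
  \<open>card N\<close> when \<open>delta N f = 2\<close>, so parent sets have to be returned by reference.\<close>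

definition outputs_dag :: "'a list \<Rightarrow> state \<Rightarrow> ('a \<times> 'a) set \<Rightarrow> bool" where
  "outputs_dag vs s D \<longleftrightarrow>
     D \<subseteq> set vs \<times> set vs \<and>
     (\<forall>i < length vs.
        (let p = mem s (reg s 0 + i)
         in (\<forall>k < mem s p. mem s (p + 1 + k) < length vs) \<and>
            parents D (vs ! i) = stored_set vs s p))"

end

theory Submission
  imports Defs
begin

text \<open>If every node independently takes a parent set of maximal score, the resulting digraph
  is a subgraph of the directed super-structure, hence a dag, and clearly no dag scores more.
  The machine first walks over the tuples to find the end of the input, then sets up an array
  of nodes pointing to an empty set with best score 0, and finally walks over the tuples
  again, updating the best parent set of the node of each tuple. This takes constant time per
  node and per tuple, and there are at most \<open>card N * delta N f\<close> tuples.\<close>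

section \<open>Total correctness with time bounds\<close>

text \<open>An upper bound in place of the exact time lets both branches of a conditional share one
  bound, and bounds simply add up along a sequence.\<close>

definition runs :: "com \<Rightarrow> state \<Rightarrow> nat \<Rightarrow> (state \<Rightarrow> bool) \<Rightarrow> bool" where
  "runs c s K Q \<longleftrightarrow> (\<exists>t s'. exec c s t s' \<and> t \<le> K \<and> Q s')"

lemma runs_mono:
  assumes "runs c s K Q" "K \<le> K'" "\<And>s'. Q s' \<Longrightarrow> Q' s'"
  shows "runs c s K' Q'"
  using assms unfolding runs_def by (meson order_trans)

lemma runs_Skip: "Q s \<Longrightarrow> runs Skip s 1 Q"
  unfolding runs_def using exec.Skip by blast

lemma runs_Seq:
  assumes "runs c1 s K1 (\<lambda>s'. runs c2 s' K2 Q)"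
  shows "runs (Seq c1 c2) s (K1 + K2) Q"
  using assms unfolding runs_def by (meson add_mono exec.Seq)

lemma runs_If:
  assumes "holds b s \<Longrightarrow> runs c1 s K Q" "\<not> holds b s \<Longrightarrow> runs c2 s K Q"
  shows "runs (If b c1 c2) s (Suc K) Q"
proof (cases "holds b s")
  case True
  then obtain t s' where "exec c1 s t s'" "t \<le> K" "Q s'"
    using assms(1) by (auto simp: runs_def)
  then show ?thesis using exec.IfTrue[OF True] unfolding runs_def by fastforce
next
  case False
  then obtain t s' where "exec c2 s t s'" "t \<le> K" "Q s'"
    using assms(2) by (auto simp: runs_def)
  then show ?thesis using exec.IfFalse[OF False] unfolding runs_def by fastforce
qed

text \<open>For loops whose number \<open>m\<close> of iterations is known beforehand: the invariant
  is indexed by the iterations already done, and the induction descends from \<open>j = m\<close>.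
  Each iteration pays \<open>Suc K\<close> for test and body; the final 1 pays for the failing
  test.\<close>

lemma runs_While:
  assumes step: "\<And>j s. j < m \<Longrightarrow> I j s \<Longrightarrow> holds b s \<and> runs c s K (I (Suc j))"
    and stop: "\<And>s. I m s \<Longrightarrow> \<not> holds b s"
    and "I 0 s"
  shows "runs (While b c) s (m * Suc K + 1) (I m)"
proof -
  have "runs (While b c) s ((m - j) * Suc K + 1) (I m)" if "j \<le> m" "I j s" for j s
    using that
  proof (induction j arbitrary: s rule: inc_induct)
    case base
    then show ?case using stop exec.WhileFalse unfolding runs_def by fastforce
  next
    case (step j)
    then obtain t1 s1 where 1: "holds b s" "exec c s t1 s1" "t1 \<le> K" "I (Suc j) s1"
      using assms(1)[of j s] by (auto simp: runs_def)
    obtain t2 s2 where 2: "exec (While b c) s1 t2 s2"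
        "t2 \<le> (m - Suc j) * Suc K + 1" "I m s2"
      using step.IH[OF 1(4)] unfolding runs_def by blast
    have "(m - j) * Suc K = Suc K + (m - Suc j) * Suc K"
      using step.hyps by (metis Suc_diff_Suc mult_Suc)
    then have "1 + t1 + t2 \<le> (m - j) * Suc K + 1" using 1 2 by simp
    then show ?case using exec.WhileTrue[OF 1(1,2) 2(1)] 2(3) unfolding runs_def by blast
  qed
  from this[of 0] show ?thesis using assms(3) by simp
qed

fun block :: "instr list \<Rightarrow> com" where
  "block [] = Skip"
| "block (i # is) = Seq (Instr i) (block is)"

text \<open>The closing \<open>Skip\<close> of a block accounts for the extra time unit. As the
  final state is a \<open>fold\<close>, simplification can execute a block symbolically.\<close>

lemma runs_block:
  assumes "Q (fold step is s)"
  shows "runs (block is) s (Suc (length is)) Q"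
proof -
  have "exec (block is) s (Suc (length is)) (fold step is s)"
  proof (induction "is" arbitrary: s)
    case Nil
    then show ?case using exec.Skip by simp
  next
    case (Cons i "is")
    show ?case using exec.Seq[OF exec.Instr Cons.IH] by simp
  qed
  then show ?thesis using assms unfolding runs_def by blast
qed

section \<open>The input in memory\<close>

text \<open>For \<open>j = length ts\<close> this is the first cell behind the input, where the
  program puts the empty set.\<close>

definition tuple_address :: "(nat \<times> nat list \<times> real) list \<Rightarrow> nat \<Rightarrow> nat" where
  "tuple_address ts j = length (concat (map tuple_cells (take j ts)))"

definition stores_tuples :: "(nat \<times> nat list \<times> real) list \<Rightarrow> state \<Rightarrow> bool" where
  "stores_tuples ts s \<longleftrightarrow>
     (\<forall>k < tuple_address ts (length ts). mem s k = concat (map tuple_cells ts) ! k) \<and>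
     (\<forall>j < length ts. rmem s j = snd (snd (ts ! j)))"

lemma tuple_address_0 [simp]: "tuple_address ts 0 = 0"
  by (simp add: tuple_address_def)

lemma tuple_address_Suc:
  "j < length ts \<Longrightarrow> tuple_address ts (Suc j) = tuple_address ts j + 2 + length (fst (snd (ts ! j)))"
  by (simp add: tuple_address_def take_Suc_conv_app_nth tuple_cells_def split_beta)

text \<open>Splitting \<open>ts\<close> around its entry \<open>j\<close> splits the concatenated
  cells accordingly. The second claim places the cell inside the input, where
  \<open>stores_tuples\<close> speaks about it.\<close>

lemma concat_map_nth_tuple:
  assumes "j < length ts" "k < length (tuple_cells (ts ! j))"
  shows "concat (map tuple_cells ts) ! (tuple_address ts j + k) = tuple_cells (ts ! j) ! k"
    and "tuple_address ts j + k < tuple_address ts (length ts)"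
proof -
  have "ts = take j ts @ ts ! j # drop (Suc j) ts"
    using assms(1) by (rule id_take_nth_drop)
  then have *: "concat (map tuple_cells ts) = concat (map tuple_cells (take j ts)) @
      tuple_cells (ts ! j) @ concat (map tuple_cells (drop (Suc j) ts))"
    by (metis concat.simps(2) concat_append list.simps(9) map_append)
  show "concat (map tuple_cells ts) ! (tuple_address ts j + k) = tuple_cells (ts ! j) ! k"
    unfolding * tuple_address_def using assms(2) by (simp add: nth_append)
  show "tuple_address ts j + k < tuple_address ts (length ts)"
    unfolding tuple_address_def take_all[OF order_refl] * using assms(2) by simp
qed

lemma stores_tuples_nth:
  assumes "stores_tuples ts s" "j < length ts"
  shows "mem s (tuple_address ts j) = fst (ts ! j)"
    and "mem s (Suc (tuple_address ts j)) = length (fst (snd (ts ! j)))"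
    and "k < length (fst (snd (ts ! j))) \<Longrightarrow>
      mem s (Suc (Suc (tuple_address ts j + k))) = fst (snd (ts ! j)) ! k"
    and "rmem s j = snd (snd (ts ! j))"
proof -
  have *: "mem s (tuple_address ts j + k) = tuple_cells (ts ! j) ! k"
    if "k < length (tuple_cells (ts ! j))" for k
    using concat_map_nth_tuple[OF assms(2) that] assms(1) by (simp add: stores_tuples_def)
  show "mem s (tuple_address ts j) = fst (ts ! j)"
    using *[of 0] by (simp add: tuple_cells_def split_beta)
  show "mem s (Suc (tuple_address ts j)) = length (fst (snd (ts ! j)))"
    using *[of 1] by (simp add: tuple_cells_def split_beta)
  show "mem s (Suc (Suc (tuple_address ts j + k))) = fst (snd (ts ! j)) ! k"
    if "k < length (fst (snd (ts ! j)))"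
    using *[of "Suc (Suc k)"] that by (simp add: tuple_cells_def split_beta)
  show "rmem s j = snd (snd (ts ! j))"
    using assms by (simp add: stores_tuples_def)
qed

text \<open>Used for the store instructions: every write goes to an address at or behind the end of
  the input, so the tuples survive.\<close>

lemma stores_tuples_cong:
  assumes "stores_tuples ts s" "\<And>k. k < tuple_address ts (length ts) \<Longrightarrow> mem s' k = mem s k"
    and "\<And>j. j < length ts \<Longrightarrow> rmem s' j = rmem s j"
  shows "stores_tuples ts s'"
  using assms by (simp add: stores_tuples_def)

lemma stores_tuples_update_reg [simp]:
  "stores_tuples ts (s\<lparr>reg := r\<rparr>) = stores_tuples ts s"
  "stores_tuples ts (s\<lparr>rreg := rr\<rparr>) = stores_tuples ts s"
  by (simp_all add: stores_tuples_def)

section \<open>The program\<close>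

text \<open>Register 2 holds the constant 1, register 3 the address of the current tuple (of the
  end of the input after the first loop), register 4 the loop counter and register 7 the
  address of the output array. The cell at the end of the input stores the empty set. The
  best score for node \<open>i\<close> lies in the real memory at address \<open>m + i\<close>, where \<open>m\<close> is the number
  of tuples.\<close>

definition find_end :: com where
  "find_end = Seq (block [Const 2 1, Const 3 0, Const 4 0])
     (While (Less 4 1)
       (block [Add 5 3 2, Load 5 5, Add 3 3 5, Add 3 3 2, Add 3 3 2, Add 4 4 2]))"

definition init_best :: com where
  "init_best = Seq (block [Const 6 0, Store 3 6, Add 7 3 2, Const 4 0, RConst 0 0])
     (While (Less 4 0)
       (block [Add 8 7 4, Store 8 3, Add 8 1 4, RStore 8 0, Add 4 4 2]))"

text \<open>Register 9 holds the address of the length cell of the current tuple. It serves both as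
  the reference to its parent set and as the starting point for moving on to the next tuple.\<close>

definition update_best :: com where
  "update_best = Seq (block [Const 3 0, Const 4 0])
     (While (Less 4 1)
       (Seq (block [Load 5 3, RLoad 1 4, Add 8 1 5, RLoad 2 8, Add 9 3 2])
         (Seq (If (RLess 2 1) (block [RStore 8 1, Add 8 7 5, Store 8 9]) Skip)
           (block [Load 5 9, Add 3 9 5, Add 3 3 2, Add 4 4 2]))))"

definition best_parents_program :: com where
  "best_parents_program =
     Seq find_end (Seq init_best (Seq update_best (block [Move 0 7])))"

section \<open>Invariants and running times of the three loops\<close>

definition after_find_end :: "nat \<Rightarrow> (nat \<times> nat list \<times> real) list \<Rightarrow> nat \<Rightarrow> state \<Rightarrow> bool" where
  "after_find_end n ts j s \<longleftrightarrow> reg s 0 = n \<and> reg s 1 = length ts \<and> reg s 2 = 1 \<and>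
     reg s 3 = tuple_address ts j \<and> reg s 4 = j \<and> stores_tuples ts s"

lemma runs_find_end:
  assumes "reg s 0 = n" "reg s 1 = length ts" "stores_tuples ts s"
  shows "runs find_end s (8 * length ts + 5) (after_find_end n ts (length ts))"
proof -
  let ?body = "block [Add 5 3 2, Load 5 5, Add 3 3 5, Add 3 3 2, Add 3 3 2, Add 4 4 2]"
  have body: "holds (Less 4 1) s \<and> runs ?body s 7 (after_find_end n ts (Suc j))"
    if "j < length ts" "after_find_end n ts j s" for j s
  proof
    show "holds (Less 4 1) s" using that by (simp add: after_find_end_def)
    show "runs ?body s 7 (after_find_end n ts (Suc j))"
      by (rule runs_mono[OF runs_block[where Q = "after_find_end n ts (Suc j)"]])
        (use that in \<open>auto simp: after_find_end_def tuple_address_Suc stores_tuples_nth(1,2)\<close>)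
  qed
  have loop: "runs (While (Less 4 1) ?body) s (length ts * Suc 7 + 1)
      (after_find_end n ts (length ts))" if "after_find_end n ts 0 s" for s
    by (rule runs_While[where I = "after_find_end n ts"])
      (use body that in \<open>auto simp: after_find_end_def\<close>)
  show ?thesis unfolding find_end_def
    by (rule runs_mono[OF runs_Seq[OF runs_block[OF loop]]])
      (use assms in \<open>auto simp: after_find_end_def\<close>)
qed

text \<open>The part of the state that the last two loops have in common and preserve, including the
  cell that represents the empty set.\<close>

definition scan_state :: "nat \<Rightarrow> (nat \<times> nat list \<times> real) list \<Rightarrow> state \<Rightarrow> bool" where
  "scan_state n ts s \<longleftrightarrow> reg s 0 = n \<and> reg s 1 = length ts \<and> reg s 2 = 1 \<and>
     reg s 7 = Suc (tuple_address ts (length ts)) \<and> mem s (tuple_address ts (length ts)) = 0 \<and>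
     stores_tuples ts s"

definition after_init :: "nat \<Rightarrow> (nat \<times> nat list \<times> real) list \<Rightarrow> nat \<Rightarrow> state \<Rightarrow> bool" where
  "after_init n ts i s \<longleftrightarrow> scan_state n ts s \<and> reg s 3 = tuple_address ts (length ts) \<and>
     reg s 4 = i \<and> rreg s 0 = 0 \<and>
     (\<forall>k<i. mem s (reg s 7 + k) = tuple_address ts (length ts) \<and> rmem s (length ts + k) = 0)"

lemma runs_init_best:
  assumes "after_find_end n ts (length ts) s"
  shows "runs init_best s (7 * n + 7) (after_init n ts n)"
proof -
  let ?body = "block [Add 8 7 4, Store 8 3, Add 8 1 4, RStore 8 0, Add 4 4 2]"
  have body: "holds (Less 4 0) s \<and> runs ?body s 6 (after_init n ts (Suc i))"
    if "i < n" "after_init n ts i s" for i s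
  proof
    show "holds (Less 4 0) s" using that by (simp add: after_init_def scan_state_def)
    \<comment> \<open>Entry \<open>i\<close> is written at addresses distinct from those of the
      entries below \<open>i\<close> and from all input cells, in both memories.\<close>
    show "runs ?body s 6 (after_init n ts (Suc i))"
      by (rule runs_mono[OF runs_block[where Q = "after_init n ts (Suc i)"]])
        (use that in \<open>auto simp: after_init_def scan_state_def less_Suc_eq
           intro: stores_tuples_cong\<close>)
  qed
  have loop: "runs (While (Less 4 0) ?body) s (n * Suc 6 + 1) (after_init n ts n)"
    if "after_init n ts 0 s" for s
    by (rule runs_While[where I = "after_init n ts"])
      (use body that in \<open>auto simp: after_init_def scan_state_def\<close>)
  show ?thesis unfolding init_best_def
    by (rule runs_mono[OF runs_Seq[OF runs_block[OF loop]]])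
      (use assms in \<open>auto simp: after_find_end_def after_init_def scan_state_def
         intro: stores_tuples_cong\<close>)
qed

text \<open>After \<open>j\<close> tuples, \<open>x\<close> is the maximum of 0 and the scores seen
  for node \<open>i\<close>, and \<open>p\<close> refers to a set realising it. The default pair
  stands for the empty set with the lower bound 0 on its score; if that score is positive, the empty
  set also occurs in a tuple. The \<open>Suc\<close> skips the node index, so that \<open>p\<close>
  points to a length cell.\<close>

definition best_entry ::
    "(nat \<times> nat list \<times> real) list \<Rightarrow> nat \<Rightarrow> nat \<Rightarrow> nat \<Rightarrow> real \<Rightarrow> bool" where
  "best_entry ts j i p x \<longleftrightarrow>
     (p = tuple_address ts (length ts) \<and> x = 0 \<or>
      (\<exists>j'<j. fst (ts ! j') = i \<and> p = Suc (tuple_address ts j') \<and> x = snd (snd (ts ! j')))) \<and>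
     (\<forall>j'<j. fst (ts ! j') = i \<longrightarrow> snd (snd (ts ! j')) \<le> x)"

lemma best_entry_0: "best_entry ts 0 i p x \<longleftrightarrow> p = tuple_address ts (length ts) \<and> x = 0"
  by (simp add: best_entry_def)

lemma best_entry_keep:
  assumes "best_entry ts j i p x" "fst (ts ! j) = i \<Longrightarrow> snd (snd (ts ! j)) \<le> x"
  shows "best_entry ts (Suc j) i p x"
  using assms unfolding best_entry_def by (auto simp: less_Suc_eq)

lemma best_entry_replace:
  assumes "best_entry ts j i p x" "fst (ts ! j) = i" "x \<le> snd (snd (ts ! j))"
  shows "best_entry ts (Suc j) i (Suc (tuple_address ts j)) (snd (snd (ts ! j)))"
  using assms unfolding best_entry_def by (fastforce simp: less_Suc_eq)

definition after_update :: "nat \<Rightarrow> (nat \<times> nat list \<times> real) list \<Rightarrow> nat \<Rightarrow> state \<Rightarrow> bool" where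
  "after_update n ts j s \<longleftrightarrow> scan_state n ts s \<and> reg s 3 = tuple_address ts j \<and> reg s 4 = j \<and>
     (\<forall>i<n. best_entry ts j i (mem s (reg s 7 + i)) (rmem s (length ts + i)))"

lemma runs_update_best:
  assumes "after_init n ts n s" and index: "\<And>j. j < length ts \<Longrightarrow> fst (ts ! j) < n"
  shows "runs update_best s (17 * length ts + 4) (after_update n ts (length ts))"
proof -
  let ?A = "[Load 5 3, RLoad 1 4, Add 8 1 5, RLoad 2 8, Add 9 3 2]"
  let ?B = "[RStore 8 1, Add 8 7 5, Store 8 9]"
  let ?C = "[Load 5 9, Add 3 9 5, Add 3 3 2, Add 4 4 2]"
  let ?body = "Seq (block ?A) (Seq (If (RLess 2 1) (block ?B) Skip) (block ?C))"
  \<comment> \<open>The state between the conditional and the advance: the entries already account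
    for tuple \<open>j\<close>, but the counter does not.\<close>
  let ?mid = "\<lambda>j s. scan_state n ts s \<and> reg s 9 = Suc (tuple_address ts j) \<and> reg s 4 = j \<and>
     (\<forall>i<n. best_entry ts (Suc j) i (mem s (reg s 7 + i)) (rmem s (length ts + i)))"
  \<comment> \<open>From the length cell, adding the length and 1 leads to the next tuple.\<close>
  have C: "runs (block ?C) s 5 (after_update n ts (Suc j))" if "j < length ts" "?mid j s" for j s
    by (rule runs_mono[OF runs_block[where Q = "after_update n ts (Suc j)"]])
      (use that in \<open>auto simp: after_update_def scan_state_def tuple_address_Suc
         stores_tuples_nth(1,2)\<close>)
  have B: "runs (If (RLess 2 1) (block ?B) Skip) (fold step ?A s) 5 (?mid j)"
    if j: "j < length ts" and inv: "after_update n ts j s" for j s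
  proof -
    define i where "i = fst (ts ! j)"
    have i: "i < n" using index[OF j] by (simp add: i_def)
    have s: "scan_state n ts s" "stores_tuples ts s" "reg s 3 = tuple_address ts j"
      "reg s 4 = j" and best: "\<And>i. i < n \<Longrightarrow>
         best_entry ts j i (mem s (reg s 7 + i)) (rmem s (length ts + i))"
      using inv by (auto simp: after_update_def scan_state_def)
    have vals: "reg (fold step ?A s) 5 = i" "reg (fold step ?A s) 8 = length ts + i"
      "reg (fold step ?A s) 9 = Suc (tuple_address ts j)" "reg (fold step ?A s) 4 = j"
      "rreg (fold step ?A s) 1 = snd (snd (ts ! j))"
      "rreg (fold step ?A s) 2 = rmem s (length ts + i)"
      "reg (fold step ?A s) 7 = reg s 7"
      "mem (fold step ?A s) = mem s" "rmem (fold step ?A s) = rmem s"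
      using s stores_tuples_nth[OF s(2) j] by (auto simp: scan_state_def i_def)
    have scan: "scan_state n ts (fold step ?A s)"
      using s by (auto simp: scan_state_def)
    define u where "u = fold step ?A s"
    note vals = vals[folded u_def] and scan = scan[folded u_def]
    have "runs (If (RLess 2 1) (block ?B) Skip) u (Suc 4) (?mid j)"
    proof (rule runs_If)
      assume less: "holds (RLess 2 1) u"
      \<comment> \<open>Only the entry of the node of tuple \<open>j\<close> is overwritten; for any
        other node tuple \<open>j\<close> is irrelevant.\<close>
      have "best_entry ts (Suc j) k (mem (fold step ?B u) (reg s 7 + k))
          (rmem (fold step ?B u) (length ts + k))" if "k < n" for k
      proof (cases "k = i")
        case True
        then show ?thesis
          using best_entry_replace[OF best[OF i]] less vals by (simp add: i_def)
      next
        case False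
        then show ?thesis
          using best_entry_keep[OF best[OF that]] vals by (simp add: i_def)
      qed
      moreover have "scan_state n ts (fold step ?B u)"
        using scan vals(1,2) by (auto simp: scan_state_def intro: stores_tuples_cong)
      ultimately show "runs (block ?B) u 4 (?mid j)"
        by (intro runs_mono[OF runs_block[where Q = "?mid j"]]) (auto simp: vals)
    next
      assume "\<not> holds (RLess 2 1) u"
      then have "?mid j u"
        using best_entry_keep[OF best] vals scan by (auto simp: i_def not_less)
      then show "runs Skip u 4 (?mid j)"
        by (intro runs_mono[OF runs_Skip[where Q = "?mid j"]]) auto
    qed
    then show ?thesis by (simp add: u_def)
  qed
  \<comment> \<open>The 16 units are 6 for \<open>?A\<close>, 5 for the conditional and 5 for
    \<open>?C\<close>.\<close>
  have body: "holds (Less 4 1) s \<and> runs ?body s 16 (after_update n ts (Suc j))"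
    if "j < length ts" "after_update n ts j s" for j s
  proof
    show "holds (Less 4 1) s" using that by (simp add: after_update_def scan_state_def)
    have "runs (If (RLess 2 1) (block ?B) Skip) (fold step ?A s) 5
        (\<lambda>s. runs (block ?C) s 5 (after_update n ts (Suc j)))"
      by (rule runs_mono[OF B[OF that]]) (use C[OF that(1)] in auto)
    then show "runs ?body s 16 (after_update n ts (Suc j))"
      by (intro runs_mono[OF runs_Seq[OF runs_block[OF runs_Seq]]]) auto
  qed
  have loop: "runs (While (Less 4 1) ?body) s (length ts * Suc 16 + 1)
      (after_update n ts (length ts))" if "after_update n ts 0 s" for s
    by (rule runs_While[where I = "after_update n ts"])
      (use body that in \<open>auto simp: after_update_def scan_state_def\<close>)
  show ?thesis unfolding update_best_def
    by (rule runs_mono[OF runs_Seq[OF runs_block[OF loop]]])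
      (use assms in \<open>auto simp: after_init_def after_update_def scan_state_def best_entry_0\<close>)
qed

definition best_array :: "nat \<Rightarrow> (nat \<times> nat list \<times> real) list \<Rightarrow> state \<Rightarrow> bool" where
  "best_array n ts s \<longleftrightarrow> stores_tuples ts s \<and> mem s (tuple_address ts (length ts)) = 0 \<and>
     (\<forall>i<n. best_entry ts (length ts) i (mem s (reg s 0 + i)) (rmem s (length ts + i)))"

lemma runs_best_parents_program:
  assumes "reg s 0 = n" "reg s 1 = length ts" "stores_tuples ts s"
    and index: "\<And>j. j < length ts \<Longrightarrow> fst (ts ! j) < n"
  shows "runs best_parents_program s (25 * length ts + 7 * n + 18) (best_array n ts)"
proof -
  have 4: "runs (block [Move 0 7]) s 2 (best_array n ts)"
    if "after_update n ts (length ts) s" for s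
    by (rule runs_mono[OF runs_block[where Q = "best_array n ts"]])
      (use that in \<open>auto simp: after_update_def scan_state_def best_array_def\<close>)
  have 3: "runs (Seq update_best (block [Move 0 7])) s (17 * length ts + 4 + 2) (best_array n ts)"
    if "after_init n ts n s" for s
    by (rule runs_Seq[OF runs_mono[OF runs_update_best[OF that index] order_refl 4]])
  have 2: "runs (Seq init_best (Seq update_best (block [Move 0 7]))) s
      (7 * n + 7 + (17 * length ts + 4 + 2)) (best_array n ts)"
    if "after_find_end n ts (length ts) s" for s
    by (rule runs_Seq[OF runs_mono[OF runs_init_best[OF that] order_refl 3]])
  have "runs best_parents_program s
      (8 * length ts + 5 + (7 * n + 7 + (17 * length ts + 4 + 2))) (best_array n ts)"
    unfolding best_parents_program_def
    by (rule runs_Seq[OF runs_mono[OF runs_find_end[OF assms(1-3)] order_refl 2]])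
  then show ?thesis by (rule runs_mono) auto
qed

section \<open>Choosing the best parent sets\<close>

lemma finite_potential_parent_sets:
  "finite N \<Longrightarrow> finite (potential_parent_sets N f v)"
  by (rule finite_subset[of _ "Pow N"]) (auto simp: potential_parent_sets_def)

lemma card_potential_parent_sets_le_delta:
  "finite N \<Longrightarrow> v \<in> N \<Longrightarrow> card (potential_parent_sets N f v) \<le> delta N f"
  by (simp add: delta_def)

text \<open>The empty set is always a potential parent set, so \<open>delta N f\<close> is at least
  1 when there are nodes. This absorbs the time spent per node.\<close>

lemma card_le_card_mult_delta:
  assumes "finite N"
  shows "card N \<le> card N * delta N f"
proof (cases "N = {}")
  case False
  then obtain v where v: "v \<in> N" by blast
  have "0 < card (potential_parent_sets N f v)"
    using finite_potential_parent_sets[OF assms]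
    by (auto simp: card_gt_0_iff potential_parent_sets_def)
  then have "1 \<le> delta N f"
    using card_potential_parent_sets_le_delta[OF assms v, of f] by simp
  then show ?thesis by simp
qed simp

text \<open>Decoded tuples are pairwise distinct, and each is determined by a node together with one
  of its potential parent sets.\<close>

lemma length_nonzero_representation_le:
  assumes "finite N" "nonzero_representation N f vs ts"
  shows "length ts \<le> card N * delta N f"
proof -
  let ?S = "SIGMA v:N. potential_parent_sets N f v"
  have fin: "finite ?S" by (intro finite_SigmaI finite_potential_parent_sets assms(1))
  have distinct: "distinct (map (decode vs) ts)" and tuples: "set (map (decode vs) ts) =
      {(v, P, f v P) | v P. v \<in> N \<and> P \<subseteq> N - {v} \<and> f v P > 0}"
    using assms(2) unfolding nonzero_representation_def by blast+
  have "length ts = card (set (map (decode vs) ts))"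
    using distinct_card[OF distinct] by simp
  also have "\<dots> \<le> card ((\<lambda>(v, P). (v, P, f v P)) ` ?S)"
    unfolding tuples using fin by (intro card_mono) (auto simp: potential_parent_sets_def)
  also have "\<dots> \<le> card ?S" by (rule card_image_le[OF fin])
  also have "\<dots> = (\<Sum>v\<in>N. card (potential_parent_sets N f v))"
    by (intro card_SigmaI ballI finite_potential_parent_sets assms(1))
  also have "\<dots> \<le> (\<Sum>v\<in>N. delta N f)"
    by (intro sum_mono card_potential_parent_sets_le_delta assms(1))
  finally show ?thesis by simp
qed

section \<open>Optimality of locally optimal parent sets\<close>

lemma parents_dag_subset:
  assumes "dag_on N D"
  shows "parents D v \<subseteq> N - {v}"
proof
  fix u assume "u \<in> parents D v"
  then have "(u, v) \<in> D" by (simp add: parents_def)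
  with assms have "u \<in> N" "(u, v) \<in> D\<^sup>+" "(v, v) \<notin> D\<^sup>+"
    by (auto simp: dag_on_def acyclic_def)
  then show "u \<in> N - {v}" by auto
qed

lemma optimal_dag_of_best_parents:
  assumes acyc: "acyclic (directed_super_structure N f)" and "D \<subseteq> N \<times> N"
    and pot: "\<And>v. v \<in> N \<Longrightarrow> parents D v \<in> potential_parent_sets N f v"
    and best: "\<And>v P. v \<in> N \<Longrightarrow> P \<subseteq> N - {v} \<Longrightarrow> f v P \<le> f v (parents D v)"
  shows "dag_on N D" and "dag_on N D' \<Longrightarrow> score N f D' \<le> score N f D"
proof -
  have "D \<subseteq> directed_super_structure N f"
  proof
    fix a assume "a \<in> D"
    moreover obtain u v where "a = (u, v)" by (cases a)
    ultimately have "u \<in> N" "v \<in> N" "u \<in> parents D v" "a = (u, v)"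
      using assms(2) by (auto simp: parents_def)
    then show "a \<in> directed_super_structure N f"
      using pot unfolding directed_super_structure_def by blast
  qed
  then show "dag_on N D"
    using assms(2) acyclic_subset[OF acyc] unfolding dag_on_def by blast
  \<comment> \<open>A dag has no loops, so its parent sets are admissible in \<open>best\<close> and
    the sums compare term by term.\<close>
  show "score N f D' \<le> score N f D" if "dag_on N D'"
    unfolding score_def by (intro sum_mono best parents_dag_subset[OF that])
qed

section \<open>From the tuples in memory to the score function\<close>

lemma nonzero_representation_nth:
  assumes "nonzero_representation N f vs ts" "j < length ts"
  defines "v \<equiv> vs ! fst (ts ! j)" and "P \<equiv> (!) vs ` set (fst (snd (ts ! j)))"
  shows "fst (ts ! j) < length vs" and "set (fst (snd (ts ! j))) \<subseteq> {..<length vs}"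
    and "P \<subseteq> N - {v}" and "0 < f v P" and "snd (snd (ts ! j)) = f v P"
proof -
  have mem: "ts ! j \<in> set ts" using assms(2) by simp
  then show "fst (ts ! j) < length vs" "set (fst (snd (ts ! j))) \<subseteq> {..<length vs}"
    using assms(1) by (auto simp: nonzero_representation_def split_beta)
  have "decode vs (ts ! j) \<in> {(v, P, f v P) | v P. v \<in> N \<and> P \<subseteq> N - {v} \<and> f v P > 0}"
    using assms(1) mem unfolding nonzero_representation_def by (metis image_eqI set_map)
  then show "P \<subseteq> N - {v}" "0 < f v P" "snd (snd (ts ! j)) = f v P"
    by (auto simp: decode_def split_beta v_def P_def)
qed

lemma nonzero_representation_complete:
  assumes "nonzero_representation N f vs ts" "i < length vs" "P \<subseteq> N - {vs ! i}" "0 < f (vs ! i) P"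
  obtains j where "j < length ts" "fst (ts ! j) = i" "snd (snd (ts ! j)) = f (vs ! i) P"
proof -
  have N: "distinct vs" "set vs = N" and tuples: "set (map (decode vs) ts) =
      {(v, P, f v P) | v P. v \<in> N \<and> P \<subseteq> N - {v} \<and> f v P > 0}"
    using assms(1) unfolding nonzero_representation_def by blast+
  have "(vs ! i, P, f (vs ! i) P) \<in> set (map (decode vs) ts)"
    unfolding tuples using assms(2-4) N(2) by auto
  then obtain j where j: "j < length ts" "decode vs (ts ! j) = (vs ! i, P, f (vs ! i) P)"
    by (auto simp: in_set_conv_nth)
  \<comment> \<open>Decoding only identifies the node; distinctness of \<open>vs\<close> recovers
    its index.\<close>
  then have "vs ! fst (ts ! j) = vs ! i" by (simp add: decode_def split_beta)
  then have "fst (ts ! j) = i"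
    using nonzero_representation_nth(1)[OF assms(1) j(1)] assms(2) N(1)
    by (simp add: nth_eq_iff_index_eq)
  then show thesis using that[OF j(1)] j(2) by (simp add: decode_def split_beta)
qed

lemma stored_set_tuple:
  assumes "stores_tuples ts s" "j < length ts"
  shows "stored_set vs s (Suc (tuple_address ts j)) = (!) vs ` set (fst (snd (ts ! j)))"
proof -
  have "stored_set vs s (Suc (tuple_address ts j)) =
      (\<lambda>k. vs ! (fst (snd (ts ! j)) ! k)) ` {..<length (fst (snd (ts ! j)))}"
    unfolding stored_set_def using stores_tuples_nth[OF assms] by auto
  also have "\<dots> = (!) vs ` set (fst (snd (ts ! j)))"
    by (auto simp: set_conv_nth)
  finally show ?thesis .
qed

text \<open>Scores missing from the representation are 0, so no parent set of the node scores above
  \<open>max 0 x\<close>, and the stored set reaches this value.\<close>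

lemma best_entry_stored_set:
  assumes rep: "nonzero_representation N f vs ts" and lsf: "local_score_function N f"
    and mem: "stores_tuples ts s" "mem s (tuple_address ts (length ts)) = 0"
    and i: "i < length vs" and best: "best_entry ts (length ts) i p x"
  shows "k < mem s p \<Longrightarrow> mem s (p + 1 + k) < length vs"
    and "stored_set vs s p \<in> potential_parent_sets N f (vs ! i)"
    and "P \<subseteq> N - {vs ! i} \<Longrightarrow> f (vs ! i) P \<le> f (vs ! i) (stored_set vs s p)"
proof -
  have "vs ! i \<in> N" using rep i by (auto simp: nonzero_representation_def)
  then have nonneg: "0 \<le> f (vs ! i) Q" if "Q \<subseteq> N - {vs ! i}" for Q
    using lsf that by (simp add: local_score_function_def)
  have upper: "f (vs ! i) P \<le> max 0 x" if "P \<subseteq> N - {vs ! i}" for P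
  proof (cases "0 < f (vs ! i) P")
    case True
    from nonzero_representation_complete[OF rep i that True] best
    show ?thesis unfolding best_entry_def by (metis max.coboundedI2)
  qed simp
  have "(\<forall>k < mem s p. mem s (p + 1 + k) < length vs) \<and>
      stored_set vs s p \<in> potential_parent_sets N f (vs ! i) \<and>
      max 0 x \<le> f (vs ! i) (stored_set vs s p)"
    \<comment> \<open>For the default entry, \<open>x = 0\<close> and the empty set has non-negative
      score; otherwise \<open>x\<close> is the positive score of the stored tuple.\<close>
    using best unfolding best_entry_def
  proof (elim conjE disjE exE)
    assume "p = tuple_address ts (length ts)" "x = 0"
    then show ?thesis
      using mem nonneg[of "{}"] by (simp add: stored_set_def potential_parent_sets_def)
  next
    fix j
    assume j: "j < length ts" "fst (ts ! j) = i" "p = Suc (tuple_address ts j)"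
      "x = snd (snd (ts ! j))"
    note nth = nonzero_representation_nth[OF rep j(1), unfolded j(2)]
    have "mem s (p + 1 + k) < length vs" if "k < mem s p" for k
    proof -
      have k: "k < length (fst (snd (ts ! j)))"
        using that stores_tuples_nth(2)[OF mem(1) j(1)] by (simp add: j(3))
      then show ?thesis
        using stores_tuples_nth(3)[OF mem(1) j(1) k] subsetD[OF nth(2) nth_mem[OF k]]
        by (simp add: j(3))
    qed
    then show ?thesis
      using nth stored_set_tuple[OF mem(1) j(1), of vs]
      by (simp add: j(3,4) potential_parent_sets_def)
  qed
  then show "k < mem s p \<Longrightarrow> mem s (p + 1 + k) < length vs"
    and "stored_set vs s p \<in> potential_parent_sets N f (vs ! i)"
    and "P \<subseteq> N - {vs ! i} \<Longrightarrow> f (vs ! i) P \<le> f (vs ! i) (stored_set vs s p)"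
    using upper[of P] by auto
qed

lemma best_array_outputs_optimal_dag:
  assumes rep: "nonzero_representation N f vs ts" and lsf: "local_score_function N f"
    and acyc: "acyclic (directed_super_structure N f)"
    and array: "best_array (length vs) ts s"
  obtains D where "outputs_dag vs s D" "dag_on N D"
    "\<And>D'. dag_on N D' \<Longrightarrow> score N f D' \<le> score N f D"
proof -
  have vs: "distinct vs" "set vs = N"
    using rep by (auto simp: nonzero_representation_def)
  define p where "p i = mem s (reg s 0 + i)" for i
  \<comment> \<open>The digraph is read off the array; since \<open>vs\<close> is distinct, the head
    of an arc determines the entry it comes from.\<close>
  define D where "D = {(u, vs ! i) | u i. i < length vs \<and> u \<in> stored_set vs s (p i)}"
  have mem: "stores_tuples ts s" "mem s (tuple_address ts (length ts)) = 0"
    using array by (auto simp: best_array_def)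
  have "best_entry ts (length ts) i (p i) (rmem s (length ts + i))" if "i < length vs" for i
    using array that by (simp add: best_array_def p_def)
  note entry = best_entry_stored_set[OF rep lsf mem _ this]
  have par: "parents D (vs ! i) = stored_set vs s (p i)" if "i < length vs" for i
    using that vs(1) by (auto simp: parents_def D_def nth_eq_iff_index_eq)
  have sub: "D \<subseteq> N \<times> N"
    using entry(2) vs(2) by (fastforce simp: D_def potential_parent_sets_def)
  have out: "outputs_dag vs s D"
    using sub entry(1) par vs(2) by (auto simp: outputs_dag_def Let_def p_def)
  have pot: "parents D v \<in> potential_parent_sets N f v" if "v \<in> N" for v
    using that entry(2) par vs(2) by (metis in_set_conv_nth)
  have best: "f v P \<le> f v (parents D v)" if "v \<in> N" "P \<subseteq> N - {v}" for v P
    using that entry(3) par vs(2) by (metis in_set_conv_nth)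
  show thesis
    using that[OF out] optimal_dag_of_best_parents[OF acyc sub pot best] by blast
qed

theorem theorem7:
  shows "\<exists>(prog :: com) (c :: nat).
    \<forall>(N :: 'a set) (f :: 'a \<Rightarrow> 'a set \<Rightarrow> real) vs ts s.
      finite N \<longrightarrow>
      local_score_function N f \<longrightarrow>
      acyclic (directed_super_structure N f) \<longrightarrow>
      nonzero_representation N f vs ts \<longrightarrow>
      input_state vs ts s \<longrightarrow>
      (\<exists>t s' D.
        exec prog s t s' \<and>
        t \<le> c * max 1 (card N * delta N f) \<and>
        outputs_dag vs s' D \<and>
        dag_on N D \<and>
        (\<forall>D'. dag_on N D' \<longrightarrow> score N f D' \<le> score N f D))"
\<comment> \<open>The constant is 50 = 25 + 7 + 18: the numbers of tuples and of nodes are both at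
  most \<open>card N * delta N f\<close>, and \<open>max 1\<close> covers the constant term.\<close>
proof (rule exI[of _ best_parents_program], rule exI[of _ 50], intro allI impI)
  fix N :: "'a set" and f :: "'a \<Rightarrow> 'a set \<Rightarrow> real" and vs ts s
  assume fin: "finite N" and lsf: "local_score_function N f"
    and acyc: "acyclic (directed_super_structure N f)"
    and rep: "nonzero_representation N f vs ts" and inp: "input_state vs ts s"
  have stored: "reg s 0 = length vs" "reg s 1 = length ts" "stores_tuples ts s"
    using inp by (auto simp: input_state_def stores_tuples_def tuple_address_def Let_def)
  have "runs best_parents_program s (25 * length ts + 7 * length vs + 18)
      (best_array (length vs) ts)"
    using runs_best_parents_program[OF stored nonzero_representation_nth(1)[OF rep]] .
  then obtain t s' where t: "exec best_parents_program s t s'"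
      "t \<le> 25 * length ts + 7 * length vs + 18" and array: "best_array (length vs) ts s'"
    by (auto simp: runs_def)
  have "length vs = card N"
    using rep distinct_card unfolding nonzero_representation_def by metis
  then have "t \<le> 50 * max 1 (card N * delta N f)"
    using t(2) length_nonzero_representation_le[OF fin rep] card_le_card_mult_delta[OF fin, of f]
    by linarith
  moreover obtain D where "outputs_dag vs s' D" "dag_on N D"
      "\<And>D'. dag_on N D' \<Longrightarrow> score N f D' \<le> score N f D"
    using best_array_outputs_optimal_dag[OF rep lsf acyc array] by metis
  ultimately show "\<exists>t s' D. exec best_parents_program s t s' \<and>
      t \<le> 50 * max 1 (card N * delta N f) \<and> outputs_dag vs s' D \<and> dag_on N D \<and>
      (\<forall>D'. dag_on N D' \<longrightarrow> score N f D' \<le> score N f D)"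
    using t(1) by blast
qed

end
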